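(* Let $G$ be a (fork, $P_6$)-free graph which is not perfectly divisible. Then $G$ has a homogeneous set.
   Context: All graphs are finite and simple. $P_n$ is the path on $n$ vertices. The fork is the graph obtained from the complete bipartite graph $K_{1,3}$ by subdividing one edge once (equivalently, vertices $v_1,\dots,v_5$ where $v_3$ is adjacent to $v_2,v_4,v_5$, $\{v_2,v_4,v_5\}$ is stable, $v_1$ is adjacent only to $v_2$). For a graph $H$, $G$ is $H$-free if no induced subgraph of $G$ is isomorphic to $H$; $(H_1,H_2)$-free means $H_1$-free and $H_2$-free. A graph is perfect if every induced subgraph $H$ satisfies $\chi(H)=\omega(H)$. A graph $G$ is perfectly divisible if for every induced subgraph $H$ of $G$, $V(H)$ can be partitioned into two sets $A,B$ such that $H[A]$ is perfect and $\omega(H[B])<\omega(H)$. A set $S\subseteq V(G)$ is a homogeneous set if $1<|S|<|V(G)|$ and every vertex of $V(G)\setminus S$ is either adjacent to all vertices of $S$ or to none of them. *)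

theory Defs
  imports Main
begin

text \<open>A finite simple graph is given by a finite vertex set V and an adjacency
relation E; only E restricted to V matters, and we require E to be symmetric and
irreflexive.  Induced subgraphs of (V,E) are given by subsets S of V (with E).\<close>

definition simple_graph :: "'a set \<Rightarrow> ('a \<Rightarrow> 'a \<Rightarrow> bool) \<Rightarrow> bool" where
  "simple_graph V E \<longleftrightarrow> finite V \<and> (\<forall>x\<in>V. \<forall>y\<in>V. E x y \<longleftrightarrow> E y x) \<and> (\<forall>x\<in>V. \<not> E x x)"

definition is_clique :: "('a \<Rightarrow> 'a \<Rightarrow> bool) \<Rightarrow> 'a set \<Rightarrow> bool" where
  "is_clique E K \<longleftrightarrow> (\<forall>x\<in>K. \<forall>y\<in>K. x \<noteq> y \<longrightarrow> E x y)"

definition clique_number :: "'a set \<Rightarrow> ('a \<Rightarrow> 'a \<Rightarrow> bool) \<Rightarrow> nat" where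
  "clique_number S E = Max {card K | K. K \<subseteq> S \<and> is_clique E K}"

definition proper_colouring :: "'a set \<Rightarrow> ('a \<Rightarrow> 'a \<Rightarrow> bool) \<Rightarrow> nat \<Rightarrow> ('a \<Rightarrow> nat) \<Rightarrow> bool" where
  "proper_colouring S E k c \<longleftrightarrow> (\<forall>x\<in>S. c x < k) \<and> (\<forall>x\<in>S. \<forall>y\<in>S. E x y \<longrightarrow> c x \<noteq> c y)"

definition chromatic_number :: "'a set \<Rightarrow> ('a \<Rightarrow> 'a \<Rightarrow> bool) \<Rightarrow> nat" where
  "chromatic_number S E = (LEAST k. \<exists>c. proper_colouring S E k c)"

definition perfect :: "'a set \<Rightarrow> ('a \<Rightarrow> 'a \<Rightarrow> bool) \<Rightarrow> bool" where
  "perfect V E \<longleftrightarrow> (\<forall>H\<subseteq>V. chromatic_number H E = clique_number H E)"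

definition perfectly_divisible :: "'a set \<Rightarrow> ('a \<Rightarrow> 'a \<Rightarrow> bool) \<Rightarrow> bool" where
  "perfectly_divisible V E \<longleftrightarrow>
     (\<forall>H\<subseteq>V. H \<noteq> {} \<longrightarrow> (\<exists>A B. A \<union> B = H \<and> A \<inter> B = {} \<and> perfect A E
                    \<and> clique_number B E < clique_number H E))"

definition contains_induced :: "'a set \<Rightarrow> ('a \<Rightarrow> 'a \<Rightarrow> bool) \<Rightarrow> nat \<Rightarrow> (nat \<Rightarrow> nat \<Rightarrow> bool) \<Rightarrow> bool" where
  "contains_induced V E n HE \<longleftrightarrow>
     (\<exists>f. inj_on f {0..<n} \<and> f ` {0..<n} \<subseteq> V \<and>
          (\<forall>i<n. \<forall>j<n. i \<noteq> j \<longrightarrow> (E (f i) (f j) \<longleftrightarrow> HE i j)))"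

definition free_of :: "'a set \<Rightarrow> ('a \<Rightarrow> 'a \<Rightarrow> bool) \<Rightarrow> nat \<Rightarrow> (nat \<Rightarrow> nat \<Rightarrow> bool) \<Rightarrow> bool" where
  "free_of V E n HE \<longleftrightarrow> \<not> contains_induced V E n HE"

definition path_adj :: "nat \<Rightarrow> nat \<Rightarrow> bool" where
  "path_adj i j \<longleftrightarrow> i = j + 1 \<or> j = i + 1"

definition fork_adj :: "nat \<Rightarrow> nat \<Rightarrow> bool" where
  "fork_adj i j \<longleftrightarrow> {i, j} \<in> {{0,1}, {1,2}, {2,3}, {2,4}}"

definition homogeneous_set :: "'a set \<Rightarrow> ('a \<Rightarrow> 'a \<Rightarrow> bool) \<Rightarrow> 'a set \<Rightarrow> bool" where
  "homogeneous_set V E S \<longleftrightarrow> S \<subseteq> V \<and> 1 < card S \<and> card S < card V \<and>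
     (\<forall>v\<in>V - S. (\<forall>s\<in>S. E v s) \<or> (\<forall>s\<in>S. \<not> E v s))"

end

theory Submission
  imports Defs
begin

text \<open>
  If no vertex v of an induced subgraph H can serve as the centre of the division of H into the
  perfect part \<open>H - N(v)\<close> and \<open>N(v)\<close>, then the non-neighbours of v contain a minimally imperfect
  graph W. The strong perfect graph theorem is avoided: of W only the criticality of its
  colourings and the absence of homogeneous sets (Lovasz) are used. Let x have a neighbour
  anticomplete to W and suppose that x is mixed on W. Forks and P6s through x force the
  neighbours of x in W to form a clique A, each of whose members has a clique as its neighbourhood
  in \<open>W - A\<close>. Deleting a suitable a in A, colouring the rest with \<open>\<omega>(W)\<close> colours and performing
  Kempe swaps then yields a clique with \<open>\<omega>(W) + 1\<close> vertices. So such an x is complete or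
  anticomplete to W, and W extends to a homogeneous set of the whole graph.\<close>

section \<open>Minimally imperfect graphs\<close>

text \<open>Colourability with \<open>clique_number\<close> many colours stands in for the equation
  of chromatic and clique number, since the former is never smaller on a finite set. Minimality then
  hands over colourings directly.\<close>

definition min_imperfect :: "('a \<Rightarrow> 'a \<Rightarrow> bool) \<Rightarrow> 'a set \<Rightarrow> bool" where
  "min_imperfect E W \<longleftrightarrow> finite W \<and> (\<nexists>c. proper_colouring W E (clique_number W E) c) \<and>
     (\<forall>H\<subset>W. \<exists>c. proper_colouring H E (clique_number H E) c)"

lemma finite_clique_cards:
  "finite S \<Longrightarrow> finite {card K | K. K \<subseteq> S \<and> is_clique E K}"
  by (rule finite_subset[of _ "card ` Pow S"]) auto

lemma card_clique_le:
  assumes "finite S" "K \<subseteq> S" "is_clique E K"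
  shows "card K \<le> clique_number S E"
  unfolding clique_number_def using assms finite_clique_cards by (intro Max_ge) auto

lemma clique_number_attained:
  assumes "finite S"
  obtains K where "K \<subseteq> S" "is_clique E K" "card K = clique_number S E"
proof -
  have "{} \<subseteq> S \<and> is_clique E {}" by (simp add: is_clique_def)
  then have "{card K | K. K \<subseteq> S \<and> is_clique E K} \<noteq> {}" by blast
  from Max_in[OF finite_clique_cards[OF assms] this] that show ?thesis
    unfolding clique_number_def by auto
qed

lemma clique_number_mono:
  assumes "finite S" "T \<subseteq> S"
  shows "clique_number T E \<le> clique_number S E"
  using clique_number_attained[of T E] card_clique_le assms
  by (metis finite_subset subset_trans)

lemma proper_colouring_mono:
  assumes "proper_colouring S E k c" "T \<subseteq> S" "k \<le> l"
  shows "proper_colouring T E l c"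
  using assms unfolding proper_colouring_def by (meson order_less_le_trans subsetD)

lemma inj_on_proper_clique:
  assumes "proper_colouring S E k c" "K \<subseteq> S" "is_clique E K"
  shows "inj_on c K"
  using assms unfolding proper_colouring_def is_clique_def inj_on_def by blast

lemma min_imperfect_colourable:
  assumes "min_imperfect E W" "H \<subset> W" "clique_number H E \<le> k"
  obtains c where "proper_colouring H E k c"
proof -
  obtain c where "proper_colouring H E (clique_number H E) c"
    using assms(1,2) unfolding min_imperfect_def by metis
  from proper_colouring_mono[OF this order_refl assms(3)] that show ?thesis by simp
qed

lemma ex_min_imperfect_subset:
  assumes "finite S" "\<nexists>c. proper_colouring S E (clique_number S E) c"
  obtains W where "W \<subseteq> S" "min_imperfect E W"
proof -
  let ?bad = "\<lambda>H. H \<subseteq> S \<and> (\<nexists>c. proper_colouring H E (clique_number H E) c)"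
  have "?bad S" using assms by blast
  then obtain W where W: "?bad W" and min: "\<And>H. ?bad H \<Longrightarrow> card W \<le> card H"
    using ex_has_least_nat[of ?bad S card] by blast
  have "finite W" using W assms(1) finite_subset by blast
  moreover have "\<exists>c. proper_colouring H E (clique_number H E) c" if "H \<subset> W" for H
  proof (rule ccontr)
    assume "\<nexists>c. proper_colouring H E (clique_number H E) c"
    with that W have "card W \<le> card H" by (intro min) blast
    then show False using psubset_card_mono[OF \<open>finite W\<close> that] by simp
  qed
  ultimately have "min_imperfect E W" using W unfolding min_imperfect_def by simp
  with W that show ?thesis by blast
qed

text \<open>Connectedness of the complement graph on \<open>S\<close>, in cut form: a non-edge
  crosses every cut.\<close>

definition coconnected :: "('a \<Rightarrow> 'a \<Rightarrow> bool) \<Rightarrow> 'a set \<Rightarrow> bool" where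
  "coconnected E S \<longleftrightarrow> (\<forall>T\<subset>S. T \<noteq> {} \<longrightarrow> (\<exists>a\<in>T. \<exists>b\<in>S - T. \<not> E a b))"

locale ugraph =
  fixes E :: "'a \<Rightarrow> 'a \<Rightarrow> bool"
  assumes sym: "E x y \<Longrightarrow> E y x"
    and irrefl: "\<not> E x x"
begin

lemma not_sym: "\<not> E x y \<Longrightarrow> \<not> E y x"
  using sym by blast

lemma coconnected_insert:
  assumes S: "coconnected E S" and t: "t \<in> S" "\<not> E u t"
  shows "coconnected E (insert u S)"
  unfolding coconnected_def
proof (intro allI impI)
  fix T assume T: "T \<subset> insert u S" "T \<noteq> {}"
  show "\<exists>a\<in>T. \<exists>b\<in>insert u S - T. \<not> E a b"
  proof (cases "u \<in> S")
    case True
    then show ?thesis using S T unfolding coconnected_def by (simp add: insert_absorb)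
  next
    case u: False
    consider "T = {u}" | "T = S" | "T - {u} \<subset> S" "T - {u} \<noteq> {}" using T u by blast
    then show ?thesis
    proof cases
      case 1 then show ?thesis using t u by blast
    next
      case 2 then show ?thesis using t u sym by blast
    next
      case 3
      then obtain a b where "a \<in> T - {u}" "b \<in> S - (T - {u})" "\<not> E a b"
        using S unfolding coconnected_def by blast
      then show ?thesis using u by blast
    qed
  qed
qed

text \<open>The neighbours of \<open>u\<close> in \<open>S\<close> form one side of a cut of the
  complement, and a crossing non-edge is the pair \<open>s\<close>, \<open>t\<close>. Such triples
  \<open>u\<close>, \<open>s\<close>, \<open>t\<close> are the raw material of the forks found
  later.\<close>

lemma coconnected_mixed:
  assumes "coconnected E S" "a \<in> S" "E u a" "b \<in> S" "\<not> E u b"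
  obtains s t where "s \<in> S" "t \<in> S" "E u s" "\<not> E u t" "\<not> E s t" "s \<noteq> t"
proof -
  let ?T = "{s \<in> S. E u s}"
  have "?T \<subset> S" "?T \<noteq> {}" using assms by auto
  with assms(1)[unfolded coconnected_def, rule_format, of ?T]
  have "\<exists>s\<in>?T. \<exists>t\<in>S - ?T. \<not> E s t" .
  then obtain s t where "s \<in> ?T" "t \<in> S - ?T" "\<not> E s t" by blast
  then show ?thesis using that by auto
qed

section \<open>Homogeneous sets and co-connectedness in minimally imperfect graphs\<close>

lemma min_imperfect_not_clique:
  assumes "min_imperfect E W"
  shows "\<not> is_clique E W"
proof
  assume cl: "is_clique E W"
  have fin: "finite W" using assms by (simp add: min_imperfect_def)
  obtain f where f: "bij_betw f W {0..<card W}" using ex_bij_betw_finite_nat[OF fin] by blast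
  have "proper_colouring W E (card W) f"
    unfolding proper_colouring_def
  proof (intro conjI ballI impI)
    fix x y assume "x \<in> W" "y \<in> W" "E x y"
    then show "f x \<noteq> f y" using bij_betw_imp_inj_on[OF f] irrefl by (metis inj_onD)
  qed (use bij_betwE[OF f] in auto)
  then have "proper_colouring W E (clique_number W E) f"
    using proper_colouring_mono[OF _ order_refl] card_clique_le[OF fin order_refl cl] by blast
  then show False using assms unfolding min_imperfect_def by blast
qed

text \<open>Lovasz's replication argument: s has weight m, every other vertex weight 1, and each unit
  of the weight of s is paid for by removing a colour class through s.\<close>
lemma replicated_vertex_colouring:
  assumes "finite U" "s \<in> U"
    and "\<And>H. H \<subseteq> U \<Longrightarrow> \<exists>c. proper_colouring H E (clique_number H E) c"
    and "\<And>K. K \<subseteq> U - {s} \<Longrightarrow> is_clique E K \<Longrightarrow> card K \<le> N"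
    and "\<And>K. K \<subseteq> U \<Longrightarrow> is_clique E K \<Longrightarrow> s \<in> K \<Longrightarrow> card K + m \<le> Suc N"
  shows "\<exists>c M. proper_colouring (U - {s}) E N c \<and> M \<subseteq> {..<N} \<and> card M = m \<and>
           (\<forall>u\<in>U - {s}. E s u \<longrightarrow> c u \<notin> M)"
  using assms
proof (induction m arbitrary: U N)
  case 0
  obtain K where "K \<subseteq> U - {s}" "is_clique E K" "card K = clique_number (U - {s}) E"
    using clique_number_attained 0(1) by (metis finite_Diff)
  then have "clique_number (U - {s}) E \<le> N" using 0(4) by metis
  then obtain c where "proper_colouring (U - {s}) E N c"
    using 0(3)[of "U - {s}"] proper_colouring_mono by blast
  then show ?case by (intro exI[of _ c] exI[of _ "{}"]) simp
next
  case (Suc m)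
  note fin = Suc.prems(1) and s = Suc.prems(2)
  obtain K where K: "K \<subseteq> U" "is_clique E K" "card K = clique_number U E"
    using clique_number_attained fin by metis
  \<comment> \<open>The weight of \<open>s\<close> is still at least 1 here, so the bound on cliques
    through \<open>s\<close> drops to \<open>N\<close> as well.\<close>
  have "card K \<le> N"
  proof (cases "s \<in> K")
    case True then show ?thesis using Suc.prems(5)[of K] K by simp
  next
    case False then show ?thesis using Suc.prems(4)[of K] K by blast
  qed
  then obtain c where c: "proper_colouring U E N c"
    using Suc.prems(3)[of U] proper_colouring_mono K by fastforce
  then obtain n where N: "N = Suc n" using s unfolding proper_colouring_def by (cases N) auto
  \<comment> \<open>The colour class of \<open>s\<close> is removed while \<open>s\<close> itself
    stays, with weight reduced by one; the cliques avoiding \<open>s\<close> then miss one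
    colour.\<close>
  let ?X = "{u \<in> U. c u = c s}" let ?H = "U - (?X - {s})"
  have clH: "card K \<le> n" if K: "K \<subseteq> ?H - {s}" "is_clique E K" for K
  proof -
    have "inj_on c K" using inj_on_proper_clique[OF c] K by blast
    moreover have "c ` K \<subseteq> {..<N} - {c s}" using K c unfolding proper_colouring_def by auto
    ultimately have "card K \<le> card ({..<N} - {c s})"
      by (metis card_image card_mono finite_Diff finite_lessThan)
    also have "\<dots> = n" using c s N by (simp add: proper_colouring_def)
    finally show ?thesis .
  qed
  have "\<exists>c M. proper_colouring (?H - {s}) E n c \<and> M \<subseteq> {..<n} \<and> card M = m \<and>
           (\<forall>u\<in>?H - {s}. E s u \<longrightarrow> c u \<notin> M)"
  proof (rule Suc.IH)
    show "finite ?H" "s \<in> ?H" using fin s by auto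
    show "\<exists>c. proper_colouring H E (clique_number H E) c" if "H \<subseteq> ?H" for H
      using that by (intro Suc.prems(3)) blast
    show "card K \<le> n" if "K \<subseteq> ?H - {s}" "is_clique E K" for K using clH that .
    show "card K + m \<le> Suc n" if "K \<subseteq> ?H" "is_clique E K" "s \<in> K" for K
      using Suc.prems(5)[of K] that N by auto
  qed
  then obtain d M where d: "proper_colouring (?H - {s}) E n d" and M: "M \<subseteq> {..<n}" "card M = m"
    and dM: "\<forall>u\<in>?H - {s}. E s u \<longrightarrow> d u \<notin> M" by blast
  \<comment> \<open>The removed class comes back with the fresh colour \<open>n\<close>. It is
    stable and contains \<open>s\<close>, so no neighbour of \<open>s\<close> gets \<open>n\<close>,
    and \<open>n\<close> may join \<open>M\<close>.\<close>
  let ?d = "\<lambda>u. if u \<in> ?X then n else d u"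
  have "proper_colouring (U - {s}) E N ?d"
    unfolding proper_colouring_def
  proof (intro conjI ballI impI)
    fix u assume "u \<in> U - {s}"
    then show "?d u < N" using d N unfolding proper_colouring_def by (auto simp: less_Suc_eq)
  next
    fix u w assume uw: "u \<in> U - {s}" "w \<in> U - {s}" "E u w"
    have "c u \<noteq> c w" using c uw unfolding proper_colouring_def by blast
    moreover have "u \<notin> ?X \<Longrightarrow> d u < n" "w \<notin> ?X \<Longrightarrow> d w < n"
      using d uw unfolding proper_colouring_def by blast+
    moreover have "u \<notin> ?X \<Longrightarrow> w \<notin> ?X \<Longrightarrow> d u \<noteq> d w"
      using d uw unfolding proper_colouring_def by blast
    ultimately show "?d u \<noteq> ?d w" by auto
  qed
  moreover have "insert n M \<subseteq> {..<N}" using M N by auto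
  moreover have "card (insert n M) = Suc m"
    using M finite_subset[OF M(1)] by (subst card_insert_disjoint) auto
  moreover have "?d u \<notin> insert n M" if u: "u \<in> U - {s}" "E s u" for u
  proof -
    have "u \<notin> ?X" using c u s unfolding proper_colouring_def by force
    then have "u \<in> ?H - {s}" using u by blast
    then have "d u < n" "d u \<notin> M" using u d dM unfolding proper_colouring_def by blast+
    then show ?thesis using \<open>u \<notin> ?X\<close> by auto
  qed
  ultimately show ?case by blast
qed

text \<open>Contract \<open>S\<close> to one vertex \<open>s\<close> whose weight is the clique
  number of \<open>S\<close>. The replication lemma colours \<open>W - S\<close> and keeps that many
  colours away from the neighbours of \<open>s\<close>; these colours suffice for \<open>S\<close>
  by minimality of \<open>W\<close>, and the two colourings fit together.\<close>

lemma min_imperfect_no_homogeneous: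
  assumes W: "min_imperfect E W"
  shows "\<not> homogeneous_set W E S"
proof
  assume S: "homogeneous_set W E S"
  have fin: "finite W" using W by (simp add: min_imperfect_def)
  have SW: "S \<subset> W" using S by (auto simp: homogeneous_set_def)
  have finS: "finite S" using SW fin finite_subset by blast
  obtain s where s: "s \<in> S" using S by (fastforce simp: homogeneous_set_def)
  have "S \<noteq> {s}" using S by (auto simp: homogeneous_set_def)
  then have UW: "W - S \<union> {s} \<subset> W" using s SW by blast
  have hom: "E s u \<Longrightarrow> t \<in> S \<Longrightarrow> E t u" "E t u \<Longrightarrow> t \<in> S \<Longrightarrow> E s u" if "u \<in> W - S" for t u
    using S that s sym unfolding homogeneous_set_def by blast+
  let ?U = "W - S \<union> {s}" and ?m = "clique_number S E" and ?N = "clique_number W E"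
  obtain L where L: "L \<subseteq> S" "is_clique E L" "card L = ?m"
    using clique_number_attained[OF finS] by metis
  have "\<exists>c M. proper_colouring (?U - {s}) E ?N c \<and> M \<subseteq> {..<?N} \<and> card M = ?m \<and>
           (\<forall>u\<in>?U - {s}. E s u \<longrightarrow> c u \<notin> M)"
  proof (rule replicated_vertex_colouring)
    show "finite ?U" "s \<in> ?U" using fin by auto
    show "\<exists>c. proper_colouring H E (clique_number H E) c" if "H \<subseteq> ?U" for H
    proof -
      have "H \<subset> W" using that UW by blast
      then show ?thesis using W unfolding min_imperfect_def by blast
    qed
    show "card K \<le> ?N" if "K \<subseteq> ?U - {s}" "is_clique E K" for K
      using card_clique_le[OF fin _ that(2)] that(1) by blast
    show "card K + ?m \<le> Suc ?N" if K: "K \<subseteq> ?U" "is_clique E K" "s \<in> K" for K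
    proof -
      \<comment> \<open>Replacing \<open>s\<close> by a maximum clique \<open>L\<close> of
        \<open>S\<close> keeps \<open>K\<close> a clique, because every neighbour of
        \<open>s\<close> outside \<open>S\<close> is complete to \<open>S\<close>.\<close>
      have "is_clique E (K - {s} \<union> L)"
        unfolding is_clique_def
      proof (intro ballI impI)
        fix y z assume yz: "y \<in> K - {s} \<union> L" "z \<in> K - {s} \<union> L" "y \<noteq> z"
        have KL: "E a b" if "a \<in> K - {s}" "b \<in> L" for a b
        proof -
          have "E s a" using K that by (auto simp: is_clique_def)
          then show ?thesis using hom(1)[of a b] sym K L that by blast
        qed
        then show "E y z" using yz K(2) L(2) sym unfolding is_clique_def by blast
      qed
      then have "card (K - {s} \<union> L) \<le> ?N"
        using K L SW by (intro card_clique_le[OF fin]) auto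
      moreover have "card (K - {s} \<union> L) = card (K - {s}) + card L"
        using K L finite_subset[OF L(1) finS] finite_subset[OF K(1)] fin
        by (intro card_Un_disjoint) auto
      moreover have "Suc (card (K - {s})) = card K"
        using K finite_subset[OF K(1)] fin by (intro card_Suc_Diff1) auto
      ultimately show ?thesis using L by simp
    qed
  qed
  then obtain c M where c: "proper_colouring (?U - {s}) E ?N c" and M: "M \<subseteq> {..<?N}" "card M = ?m"
    and cM: "\<And>u. u \<in> W - S \<Longrightarrow> E s u \<Longrightarrow> c u \<notin> M" using s by blast
  obtain d where d: "proper_colouring S E ?m d" using min_imperfect_colourable[OF W SW order_refl] .
  have "finite M" using M finite_subset by blast
  then obtain f where f: "bij_betw f {..<?m} M"
    using M by (metis atLeast0LessThan bij_betw_inv ex_bij_betw_finite_nat)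
  let ?c = "\<lambda>u. if u \<in> S then f (d u) else c u"
  have dM: "f (d u) \<in> M" if "u \<in> S" for u
    using d f that unfolding proper_colouring_def bij_betw_def by blast
  have cross: "c u \<noteq> f (d t)" if "u \<in> W - S" "t \<in> S" "E t u" for t u
    using cM[of u] hom(2)[of u t] dM[of t] that by force
  have "proper_colouring W E ?N ?c"
    unfolding proper_colouring_def
  proof (intro conjI ballI impI)
    fix u assume "u \<in> W"
    then show "?c u < ?N" using c M dM s unfolding proper_colouring_def by auto
  next
    fix u w assume uw: "u \<in> W" "w \<in> W" "E u w"
    have "f (d u) \<noteq> f (d w)" if "u \<in> S" "w \<in> S"
    proof -
      have "d u \<noteq> d w" "d u < ?m" "d w < ?m" using d uw that unfolding proper_colouring_def by auto
      then show ?thesis using f unfolding bij_betw_def inj_on_def by auto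
    qed
    moreover have "c u \<noteq> c w" if "u \<notin> S" "w \<notin> S"
      using c uw that s unfolding proper_colouring_def by blast
    ultimately show "?c u \<noteq> ?c w" using cross[of u w] cross[of w u] uw sym[OF uw(3)] by auto
  qed
  then show False using W unfolding min_imperfect_def by blast
qed

text \<open>If \<open>T\<close> is complete to \<open>W - T\<close>, each of the two sides is
  homogeneous unless it is a single vertex. Then \<open>W\<close> is one edge, hence a
  clique.\<close>

lemma min_imperfect_coconnected:
  assumes W: "min_imperfect E W"
  shows "coconnected E W"
  unfolding coconnected_def
proof (intro allI impI, rule ccontr)
  fix T assume T: "T \<subset> W" "T \<noteq> {}" and no: "\<not> (\<exists>a\<in>T. \<exists>b\<in>W - T. \<not> E a b)"
  have all: "E a b" if "a \<in> T" "b \<in> W - T" for a b using no that by simp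
  have fin: "finite W" using W by (simp add: min_imperfect_def)
  have one: "card S = 1" if S: "S \<subset> W" "S \<noteq> {}" and h: "\<forall>a\<in>W - S. \<forall>b\<in>S. E a b" for S
  proof -
    have "card S > 0" "card S < card W"
      using S fin finite_subset[of S W] psubset_card_mono by (auto simp: card_gt_0_iff)
    then show ?thesis using min_imperfect_no_homogeneous[OF W, of S] S h
      unfolding homogeneous_set_def by fastforce
  qed
  have "card T = 1" using T all sym by (intro one) auto
  moreover have "card (W - T) = 1" using T all by (intro one) auto
  ultimately obtain a b where "T = {a}" "W - T = {b}" by (auto simp: card_1_singleton_iff)
  then have "W = {a, b}" "E a b" using T all[of a b] by auto
  then have "is_clique E W" using sym unfolding is_clique_def by auto
  then show False using min_imperfect_not_clique W by blast
qed

end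

section \<open>A clique with clique neighbourhoods in a minimally imperfect graph\<close>

text \<open>In the application, \<open>A\<close> and \<open>B\<close> are the neighbours and
  non-neighbours in W of an outside vertex x that has a neighbour anticomplete to W. The last three
  assumptions exclude two forks and a P6 that start with x or with this neighbour.\<close>

locale clique_split = ugraph +
  fixes A B :: "'a set"
  assumes min_imp: "min_imperfect E (A \<union> B)"
    and disj: "A \<inter> B = {}"
    and clique_A: "is_clique E A"
    and nbr_clique: "\<lbrakk>a \<in> A; b \<in> B; b' \<in> B; E a b; E a b'; b \<noteq> b'\<rbrakk> \<Longrightarrow> E b b'"
    and second_clique: "\<lbrakk>a \<in> A; b \<in> B; y \<in> B; z \<in> B; E a b; E b y; E b z; \<not> E a y; \<not> E a z; y \<noteq> z\<rbrakk>
      \<Longrightarrow> E y z"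
    and no_P4: "\<lbrakk>a \<in> A; b \<in> B; y \<in> B; z \<in> B; E a b; E b y; E y z; \<not> E a y; \<not> E a z; \<not> E b z\<rbrakk>
      \<Longrightarrow> False"
begin

section \<open>Kempe swaps in a colouring of the graph minus one vertex of the clique\<close>

abbreviation "k \<equiv> clique_number (A \<union> B) E"

abbreviation "colours a c \<equiv> proper_colouring (A \<union> B - {a}) E k c"

definition "Nb a = {u \<in> A \<union> B. E a u}"

definition "unique_at a c u \<longleftrightarrow> (\<forall>w\<in>Nb a. w \<noteq> u \<longrightarrow> c w \<noteq> c u)"

lemma fin: "finite (A \<union> B)"
  using min_imp by (simp add: min_imperfect_def)

lemma colours_neq:
  assumes "colours a c" "u \<in> A \<union> B" "w \<in> A \<union> B" "u \<noteq> a" "w \<noteq> a" "E u w"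
  shows "c u \<noteq> c w"
  using assms unfolding proper_colouring_def by simp

lemma A_adj: "u \<in> A \<Longrightarrow> w \<in> A \<Longrightarrow> u \<noteq> w \<Longrightarrow> E u w"
  using clique_A by (simp add: is_clique_def)

lemma Nb_iff: "a \<in> A \<Longrightarrow> u \<in> Nb a \<longleftrightarrow> (u \<in> A \<and> u \<noteq> a) \<or> (u \<in> B \<and> E a u)"
  unfolding Nb_def using A_adj irrefl by auto

text \<open>The Kempe component of p in the colours c p and j has radius at most 2, because a longer
  one would contain an induced P4 starting at p.\<close>
lemma kempe_swap:
  assumes c: "colours a c" and a: "a \<in> A" and p: "p \<in> A" "p \<noteq> a" and j: "j < k"
    and jA: "\<And>u. u \<in> A \<Longrightarrow> u \<noteq> a \<Longrightarrow> c u \<noteq> j"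
  obtains c' where "colours a c'" "c' p = j" "\<And>u. u \<in> A \<Longrightarrow> u \<noteq> p \<Longrightarrow> c' u = c u"
    "\<And>u. u \<in> B \<Longrightarrow> c' u \<noteq> c u \<Longrightarrow>
       (c u = j \<and> E p u) \<or> (c u = c p \<and> (\<exists>n\<in>B. c n = j \<and> E p n \<and> E n u))"
proof -
  \<comment> \<open>\<open>S\<close> is the Kempe component of \<open>p\<close>, layer by layer:
    \<open>N1\<close> has colour \<open>j\<close>, \<open>N2\<close> has colour \<open>c p\<close>.
    By \<open>jA\<close> it meets \<open>A\<close> only in \<open>p\<close>.\<close>
  define N1 where "N1 = {z \<in> B. c z = j \<and> E p z}"
  define N2 where "N2 = {z \<in> B. c z = c p \<and> (\<exists>n\<in>B. c n = j \<and> E p n \<and> E n z)}"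
  define S where "S = {p} \<union> N1 \<union> N2"
  define d where "d u = (if u \<in> S then if c u = j then c p else j else c u)" for u
  have pj: "c p \<noteq> j" using jA p by blast
  have aB: "a \<notin> B" using a disj by blast
  have Scol: "c u = j \<or> c u = c p" if "u \<in> S" for u
    using that unfolding S_def N1_def N2_def by auto
  have SB: "u = p \<or> u \<in> B" if "u \<in> S" for u
    using that unfolding S_def N1_def N2_def by auto
  have closed: "w \<in> S" if u: "u \<in> S" and w: "w \<in> A \<union> B" "w \<noteq> a" "E u w" and cw: "c w = c p \<or> c w = j" for u w
  proof -
    have ua: "u \<noteq> a" "u \<in> A \<union> B" using SB[OF u] p aB by auto
    have neq: "c u \<noteq> c w" using colours_neq[OF c ua(2) w(1) ua(1) w(2,3)] .
    have wB: "w \<in> B" if "c w = j" using jA w that by auto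
    have wB': "w = p \<or> w \<in> B" if "c w = c p"
      using colours_neq[OF c, of w p] A_adj[of w p] w p that by auto
    consider "u = p" | "u \<in> N1" | "u \<in> N2" using u S_def by blast
    then show ?thesis
    proof cases
      case 1
      then have "c w = j" using neq cw by auto
      then show ?thesis using 1 w wB by (simp add: S_def N1_def)
    next
      case 2
      then have "c w = c p" using neq cw by (auto simp: N1_def)
      then show ?thesis using wB' 2 w unfolding S_def N1_def N2_def by blast
    next
      case 3
      then obtain n where n: "n \<in> B" "c n = j" "E p n" "E n u" and uB: "u \<in> B" "c u = c p"
        unfolding N2_def by blast
      have cw: "c w = j" using uB neq cw by auto
      have "\<not> E p u" using colours_neq[OF c, of p u] p ua uB by auto
      moreover have "\<not> E n w" using colours_neq[OF c, of n w] n cw aB w by auto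
      \<comment> \<open>A third layer would complete the forbidden path \<open>p\<close>,
        \<open>n\<close>, \<open>u\<close>, \<open>w\<close>; so \<open>w\<close> is already in
        \<open>N1\<close>.\<close>
      ultimately have "E p w" using no_P4[of p n u w] p n uB wB[OF cw] w by blast
      then show ?thesis using wB[OF cw] cw by (simp add: S_def N1_def)
    qed
  qed
  have cross: "d u \<noteq> d w" if u: "u \<in> S" and w: "w \<notin> S" "w \<in> A \<union> B" "w \<noteq> a" "E u w" for u w
  proof -
    have "\<not> (c w = c p \<or> c w = j)" using closed[OF u w(2,3,4)] w(1) by blast
    then show ?thesis using u w(1) by (auto simp: d_def)
  qed
  have "colours a d"
    unfolding proper_colouring_def
  proof (intro conjI ballI impI)
    fix u assume "u \<in> A \<union> B - {a}"
    then show "d u < k" using c j p unfolding proper_colouring_def d_def by auto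
  next
    fix u w assume uw: "u \<in> A \<union> B - {a}" "w \<in> A \<union> B - {a}" "E u w"
    have neq: "c u \<noteq> c w" using colours_neq[OF c] uw by blast
    consider "u \<in> S" "w \<in> S" | "u \<in> S" "w \<notin> S" | "u \<notin> S" "w \<in> S" | "u \<notin> S" "w \<notin> S" by blast
    then show "d u \<noteq> d w"
    proof cases
      case 1 then show ?thesis using Scol[of u] Scol[of w] neq pj by (auto simp: d_def)
    next
      case 2 then show ?thesis using cross uw by blast
    next
      case 3 then show ?thesis using cross[of w u] uw sym by auto
    next
      case 4 then show ?thesis using neq by (simp add: d_def)
    qed
  qed
  moreover have "d p = j" using pj by (simp add: d_def S_def)
  moreover have "d u = c u" if "u \<in> A" "u \<noteq> p" for u
  proof -
    have "u \<notin> S" using SB[of u] that disj by blast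
    then show ?thesis by (simp add: d_def)
  qed
  moreover have "(c u = j \<and> E p u) \<or> (c u = c p \<and> (\<exists>n\<in>B. c n = j \<and> E p n \<and> E n u))"
    if "u \<in> B" "d u \<noteq> c u" for u
  proof -
    have "u \<in> S" using that(2) unfolding d_def by presburger
    moreover have "u \<noteq> p" using that(1) p disj by blast
    ultimately show ?thesis unfolding S_def N1_def N2_def by blast
  qed
  ultimately show ?thesis using that by blast
qed

lemma not_colourable: "\<not> proper_colouring (A \<union> B) E k c"
  using min_imp by (simp add: min_imperfect_def)

text \<open>A colour missing around \<open>a\<close> could be given to \<open>a\<close>, which would
  colour the whole imperfect graph with \<open>k\<close> colours.\<close>

lemma all_colours_at:
  assumes c: "colours a c" and a: "a \<in> A" and i: "i < k"
  shows "\<exists>u\<in>Nb a. c u = i"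
proof (rule ccontr)
  assume no: "\<not> (\<exists>u\<in>Nb a. c u = i)"
  have "proper_colouring (A \<union> B) E k (c(a := i))"
    unfolding proper_colouring_def
  proof (intro conjI ballI impI)
    fix u assume "u \<in> A \<union> B"
    then show "(c(a := i)) u < k" using c i unfolding proper_colouring_def by auto
  next
    fix u w assume uw: "u \<in> A \<union> B" "w \<in> A \<union> B" "E u w"
    have nb: "c z \<noteq> i" if "z \<in> A \<union> B" "E a z" for z using no that by (auto simp: Nb_def)
    consider "u = a" "w \<noteq> a" | "u \<noteq> a" "w = a" | "u \<noteq> a" "w \<noteq> a" using uw irrefl by blast
    then show "(c(a := i)) u \<noteq> (c(a := i)) w"
    proof cases
      case 1 then show ?thesis using nb[of w] uw by auto
    next
      case 2 then show ?thesis using nb[of u] uw sym by auto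
    next
      case 3 then show ?thesis using colours_neq[OF c uw(1,2) 3 uw(3)] by simp
    qed
  qed
  then show False using not_colourable by blast
qed

text \<open>Swap at \<open>p\<close> so that it takes the colour of \<open>q\<close>. Some neighbour
  of \<open>a\<close> must now carry the old colour of \<open>p\<close>; it had the colour of
  \<open>q\<close> and is adjacent to \<open>p\<close>, so by uniqueness it is
  \<open>q\<close>.\<close>

lemma unique_adjacent:
  assumes c: "colours a c" and a: "a \<in> A" and p: "p \<in> A" "p \<noteq> a" "unique_at a c p"
    and q: "q \<in> B" "E a q" "unique_at a c q"
  shows "E p q"
proof (rule ccontr)
  assume pq: "\<not> E p q"
  have Nb: "p \<in> Nb a" "q \<in> Nb a" "p \<noteq> q" using p q a disj by (auto simp: Nb_iff)
  have ij: "c p \<noteq> c q" using Nb p(3) by (auto simp: unique_at_def)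
  have "q \<noteq> a" using a q disj by blast
  then have "c q < k" "c p < k" using c q p unfolding proper_colouring_def by auto
  moreover have "c u \<noteq> c q" if "u \<in> A" "u \<noteq> a" for u
    using q that a disj by (auto simp: unique_at_def Nb_iff)
  ultimately obtain c' where c': "colours a c'" "c' p = c q" "\<And>u. u \<in> A \<Longrightarrow> u \<noteq> p \<Longrightarrow> c' u = c u"
    "\<And>u. u \<in> B \<Longrightarrow> c' u \<noteq> c u \<Longrightarrow>
       (c u = c q \<and> E p u) \<or> (c u = c p \<and> (\<exists>n\<in>B. c n = c q \<and> E p n \<and> E n u))"
    using kempe_swap[OF c a p(1,2), of "c q"] by blast
  obtain u where u: "u \<in> Nb a" "c' u = c p"
    using all_colours_at[OF c'(1) a \<open>c p < k\<close>] by blast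
  have up: "u \<noteq> p" using u c'(2) ij by auto
  then have cu: "c u \<noteq> c p" using p(3) u by (auto simp: unique_at_def)
  then have "u \<in> B" using u c'(3)[of u] up a by (auto simp: Nb_iff)
  moreover have "c' u \<noteq> c u" using cu u by simp
  ultimately have "c u = c q \<and> E p u" using c'(4)[of u] cu by blast
  then show False using q(3) u(1) pq by (auto simp: unique_at_def)
qed

definition "max_attached a \<longleftrightarrow> a \<in> A \<and> (\<forall>p\<in>A. card {b \<in> B. E p b} \<le> card {b \<in> B. E a b})"

text \<open>Such a vertex t would force p to be adjacent to all B-neighbours of a, so that a and p
  were twins by the choice of a.\<close>
lemma no_common_neighbour:
  assumes c: "colours a c" and a: "max_attached a" and p: "p \<in> A" "p \<noteq> a" "unique_at a c p"
    and q: "q \<in> B" "E a q" "unique_at a c q"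
    and y: "y \<in> B" "E a y" "y \<noteq> q"
    and t: "t \<in> B" "c t = c q" "t \<noteq> q" "E t y"
  shows False
proof -
  have aA: "a \<in> A" using a by (simp add: max_attached_def)
  have at: "\<not> E a t" using q(3) t aA by (auto simp: unique_at_def Nb_iff)
  have aB: "a \<notin> B" using aA disj by blast
  have qt: "\<not> E q t" using colours_neq[OF c, of q t] q t aB by auto
  have pq: "E p q" using unique_adjacent[OF c aA p q] .
  have pt: "\<not> E p t" using nbr_clique[of p q t] p q t pq qt by blast
  have clB: "E b b'" if "b \<in> B" "b' \<in> B" "E a b" "E a b'" "b \<noteq> b'" for b b'
    using nbr_clique[OF aA] that by blast
  \<comment> \<open>Otherwise \<open>p\<close>, \<open>q\<close>, \<open>z\<close>, \<open>t\<close>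
    is an induced path excluded by \<open>no_P4\<close>.\<close>
  have far: "\<not> E z t" if z: "z \<in> B" "E a z" "\<not> E p z" for z
  proof
    assume "E z t"
    moreover have "E q z" using clB[of q z] q z pq by blast
    ultimately show False using no_P4[of p q z t] p q z t pq pt qt by blast
  qed
  have py: "E p y" using far[of y] y sym[OF t(4)] by blast
  \<comment> \<open>If \<open>p\<close> misses \<open>z\<close>, then \<open>z\<close> and
    \<open>t\<close> are two neighbours of \<open>y\<close> outside the neighbourhood of
    \<open>p\<close>, hence adjacent by \<open>second_clique\<close>, against
    \<open>far\<close>.\<close>
  have sub: "E p z" if z: "z \<in> B" "E a z" for z
  proof (rule ccontr)
    assume pz: "\<not> E p z"
    have "E y z" using clB[of y z] y z py pz by blast
    moreover have "z \<noteq> t" using z at by blast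
    ultimately have "E z t"
      using second_clique[of p y z t] p y z t py pz pt sym[OF t(4)] by blast
    then show False using far z pz by blast
  qed
  have finB: "finite B" using fin by simp
  have "{b \<in> B. E a b} = {b \<in> B. E p b}"
  proof (rule card_seteq)
    show "finite {b \<in> B. E p b}" using finB by simp
    show "{b \<in> B. E a b} \<subseteq> {b \<in> B. E p b}" using sub by blast
    show "card {b \<in> B. E p b} \<le> card {b \<in> B. E a b}" using a p by (simp add: max_attached_def)
  qed
  then have eq: "E a b \<longleftrightarrow> E p b" if "b \<in> B" for b using that by blast
  \<comment> \<open>The third vertex \<open>q\<close> makes the twin pair \<open>{a, p}\<close> a
    proper subset, as a homogeneous set requires.\<close>
  have "{a, p, q} \<subseteq> A \<union> B" using aA p q by blast
  from card_mono[OF fin this] have "card {a, p, q} \<le> card (A \<union> B)" .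
  moreover have "card {a, p, q} = 3" using p q aB disj by (auto simp: card_insert_if)
  ultimately have "card {a, p} < card (A \<union> B)" using p by simp
  moreover have "(\<forall>s\<in>{a, p}. E w s) \<or> (\<forall>s\<in>{a, p}. \<not> E w s)" if w: "w \<in> A \<union> B - {a, p}" for w
  proof (cases "w \<in> A")
    case True then show ?thesis using A_adj aA p w by auto
  next
    case False
    then show ?thesis using eq[of w] w sym by (metis DiffD1 UnE empty_iff insert_iff)
  qed
  ultimately have "homogeneous_set (A \<union> B) E {a, p}"
    using aA p unfolding homogeneous_set_def by auto
  then show False using min_imperfect_no_homogeneous[OF min_imp] by blast
qed

text \<open>The swap at \<open>x\<close> could disturb another neighbour of \<open>a\<close> only if
  it has the colour of \<open>x\<close> and lies in \<open>B\<close>, so it is \<open>y\<close>, the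
  neighbours of \<open>a\<close> in \<open>B\<close> being a clique. It would be reached through a
  vertex of colour \<open>c q\<close> adjacent to \<open>x\<close>, hence other than
  \<open>q\<close>, which \<open>no_common_neighbour\<close> excludes.\<close>

lemma swap_unique:
  assumes c: "colours a c" and a: "max_attached a" and p: "p \<in> A" "p \<noteq> a" "unique_at a c p"
    and q: "q \<in> B" "E a q" "unique_at a c q"
    and x: "x \<in> A" "x \<noteq> a" "\<not> E x q" and y: "y \<in> B" "E a y" "c x = c y"
  obtains c' where "colours a c'" "c' x = c q" "\<And>u. u \<in> Nb a \<Longrightarrow> u \<noteq> x \<Longrightarrow> c' u = c u"
proof -
  have aA: "a \<in> A" using a by (simp add: max_attached_def)
  have aB: "a \<notin> B" using aA disj by blast
  have "c q < k" using c q aB unfolding proper_colouring_def by auto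
  moreover have qA: "c u \<noteq> c q" if "u \<in> A" "u \<noteq> a" for u
    using q that aA disj by (auto simp: unique_at_def Nb_iff)
  ultimately obtain c' where c': "colours a c'" "c' x = c q" "\<And>u. u \<in> A \<Longrightarrow> u \<noteq> x \<Longrightarrow> c' u = c u"
    "\<And>u. u \<in> B \<Longrightarrow> c' u \<noteq> c u \<Longrightarrow>
       (c u = c q \<and> E x u) \<or> (c u = c x \<and> (\<exists>n\<in>B. c n = c q \<and> E x n \<and> E n u))"
    using kempe_swap[OF c aA x(1,2), of "c q"] by blast
  have yq: "y \<noteq> q" using y(3) qA[OF x(1,2)] by auto
  have "c' u = c u" if u: "u \<in> Nb a" "u \<noteq> x" for u
  proof (rule ccontr)
    assume ch: "c' u \<noteq> c u"
    then have uB: "u \<in> B" "E a u" using c'(3)[of u] u aA by (auto simp: Nb_iff)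
    have "\<not> (c u = c q \<and> E x u)" using q(3) u x(3) by (auto simp: unique_at_def)
    then obtain n where n: "c u = c x" "n \<in> B" "c n = c q" "E x n" "E n u"
      using c'(4)[OF uB(1) ch] by blast
    have "u = y"
    proof (rule ccontr)
      assume "u \<noteq> y"
      then have "E u y" using nbr_clique[OF aA uB(1) y(1)] uB y by blast
      then show False using colours_neq[OF c, of u y] uB y aB n(1) by auto
    qed
    then show False using no_common_neighbour[OF c a p q y(1,2) yq n(2,3)] n x(3) by blast
  qed
  with c' that show ?thesis by blast
qed

text \<open>Around a vertex a of A with most B-neighbours, every colour occurs, and an alternating
  path argument in the style of Koenig's theorem turns the colour classes seen by a into a clique
  of size k + 1. The set Z of B-neighbours of a that Kempe swaps can make uniquely coloured plays
  the part of the vertices reachable by alternating paths.\<close>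
lemma nonempty_split_impossible:
  assumes "A \<noteq> {}"
  shows False
proof -
  have finA: "finite A" and finB: "finite B" using fin by auto
  obtain a where a: "max_attached a"
  proof -
    let ?f = "\<lambda>p. card {b \<in> B. E p b}"
    have "Max (?f ` A) \<in> ?f ` A" using finA assms by (intro Max_in) auto
    then obtain a where "a \<in> A" "?f a = Max (?f ` A)" by fastforce
    then have "max_attached a" using finA by (simp add: max_attached_def)
    then show ?thesis using that by blast
  qed
  then have aA: "a \<in> A" by (simp add: max_attached_def)
  have aB: "a \<notin> B" using aA disj by blast
  have "A \<union> B - {a} \<subset> A \<union> B" using aA by blast
  then obtain c0 where c0: "colours a c0"
    using min_imperfect_colourable[OF min_imp] clique_number_mono[OF fin] by blast
  define B1 where "B1 = {b \<in> B. E a b}"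
  have B1: "b \<in> B \<and> E a b" if "b \<in> B1" for b using that by (simp add: B1_def)
  have finB1: "finite B1" using finB by (simp add: B1_def)
  have Nb_cases: "u \<in> A - {a} \<or> u \<in> B1" if "u \<in> Nb a" for u
    using that aA by (auto simp: Nb_iff B1_def)
  have B1_Nb: "u \<in> Nb a" if "u \<in> B1" for u using that aA by (simp add: Nb_iff B1_def)
  have A_Nb: "u \<in> Nb a" if "u \<in> A - {a}" for u using that aA by (simp add: Nb_iff)
  have B1_neq: "c u \<noteq> c w" if "colours a c" "u \<in> B1" "w \<in> B1" "u \<noteq> w" for c u w
    using colours_neq[OF that(1), of u w] nbr_clique[OF aA, of u w] B1 that aB by blast
  have A_neq: "c u \<noteq> c w" if "colours a c" "u \<in> A - {a}" "w \<in> A - {a}" "u \<noteq> w" for c u w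
    using colours_neq[OF that(1), of u w] A_adj[of u w] that by blast

  \<comment> \<open>\<open>a\<close> and \<open>B1\<close> form a clique, so \<open>B1\<close> has
    fewer than \<open>k\<close> vertices and misses a colour; that colour must occur around
    \<open>a\<close>, hence on \<open>A\<close>.\<close>
  obtain p where p: "p \<in> A - {a}" "c0 p \<notin> c0 ` B1"
  proof -
    have "is_clique E (insert a B1)"
      using nbr_clique[OF aA] B1 sym unfolding is_clique_def by blast
    moreover have "insert a B1 \<subseteq> A \<union> B" using aA B1 by blast
    ultimately have "card (insert a B1) \<le> k" using card_clique_le[OF fin] by blast
    moreover have "a \<notin> B1" using B1 aB by blast
    ultimately have "card (c0 ` B1) < k" using finB1 card_image_le[OF finB1, of c0] by simp
    then have "\<not> {..<k} \<subseteq> c0 ` B1" using card_mono[of "c0 ` B1" "{..<k}"] finB1 by auto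
    then obtain i where "i < k" "i \<notin> c0 ` B1" by blast
    moreover from all_colours_at[OF c0 aA \<open>i < k\<close>] obtain u where "u \<in> Nb a" "c0 u = i" by blast
    ultimately show ?thesis using that Nb_cases by blast
  qed

  \<comment> \<open>The colours shared by \<open>A - {a}\<close> and \<open>B1\<close> under
    \<open>c0\<close> act as the matching, and \<open>Z\<close> contains all unmatched vertices of
    \<open>B1\<close>. The last clause confines recolouring around \<open>a\<close> to vertices of
    \<open>A\<close> matched into \<open>Z\<close>, so witness colourings agree with
    \<open>c0\<close> on \<open>B1\<close> and on the remaining vertices of
    \<open>A - {a}\<close>.\<close>
  define good where "good Z \<longleftrightarrow> Z \<subseteq> B1 \<and> (\<forall>q\<in>B1. c0 q \<notin> c0 ` (A - {a}) \<longrightarrow> q \<in> Z) \<and>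
     (\<forall>y\<in>Z. \<exists>c. colours a c \<and> unique_at a c y \<and>
        (\<forall>u\<in>Nb a. c u = c0 u \<or> u \<in> A \<and> c0 u \<in> c0 ` Z))" for Z
  have Q: "good {q \<in> B1. c0 q \<notin> c0 ` (A - {a})}"
  proof -
    have "unique_at a c0 y" if "y \<in> B1" "c0 y \<notin> c0 ` (A - {a})" for y
      unfolding unique_at_def using that Nb_cases B1_neq[OF c0] by (metis imageI)
    then show ?thesis using c0 unfolding good_def by blast
  qed
  have "\<forall>Z. good Z \<longrightarrow> card Z < Suc (card B1)"
    using card_mono[OF finB1] by (simp add: good_def less_Suc_eq_le)
  from ex_has_greatest_nat[OF Q this] obtain Z
    where Z: "good Z" and maxZ: "\<And>Z'. good Z' \<Longrightarrow> card Z' \<le> card Z" by auto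
  have ZB1: "Z \<subseteq> B1" using Z by (simp add: good_def)
  have finZ: "finite Z" using ZB1 finB1 finite_subset by blast
  define A2 where "A2 = {u \<in> A - {a}. c0 u \<notin> c0 ` Z}"
  \<comment> \<open>Suppose \<open>u\<close> misses \<open>y\<close>. If the colour of
    \<open>u\<close> is absent from \<open>B1\<close>, \<open>unique_adjacent\<close> is violated.
    Otherwise \<open>u\<close> shares it with some \<open>y'\<close> outside \<open>Z\<close>, and
    moving \<open>u\<close> to the colour of \<open>y\<close> makes \<open>y'\<close> unique, so
    \<open>Z\<close> was not maximal.\<close>
  have adj: "E u y" if u: "u \<in> A2" and y: "y \<in> Z" for u y
  proof (rule ccontr)
    assume uy: "\<not> E u y"
    obtain c where c: "colours a c" "unique_at a c y"
      and cc0: "\<And>u. u \<in> Nb a \<Longrightarrow> c u = c0 u \<or> u \<in> A \<and> c0 u \<in> c0 ` Z"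
      using Z y unfolding good_def by meson
    have cB1: "c b = c0 b" if "b \<in> B1" for b using cc0[OF B1_Nb[OF that]] B1[OF that] disj by blast
    have uA: "u \<in> A" "u \<noteq> a" using u by (auto simp: A2_def)
    have cA: "unique_at a c w \<and> c w = c0 w" if w: "w \<in> A - {a}" "c0 w \<notin> c0 ` B1" for w
    proof -
      have "c w = c0 w" using cc0[OF A_Nb[OF w(1)]] w(2) ZB1 by blast
      moreover have "c z \<noteq> c w" if z: "z \<in> Nb a" "z \<noteq> w" for z
        using Nb_cases[OF z(1)]
      proof
        assume "z \<in> A - {a}" then show ?thesis using A_neq[OF c(1)] w z by blast
      next
        assume "z \<in> B1"
        then show ?thesis using cB1[of z] \<open>c w = c0 w\<close> w(2) by (metis imageI)
      qed
      ultimately show ?thesis by (simp add: unique_at_def)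
    qed
    have yB: "y \<in> B" "E a y" using y ZB1 B1 by blast+
    have cu: "c u = c0 u" using cc0[OF A_Nb, of u] u by (auto simp: A2_def)
    show False
    proof (cases "c0 u \<in> c0 ` B1")
      case False
      then have "unique_at a c u" using cA[of u] uA by blast
      then show False using unique_adjacent[OF c(1) aA uA _ yB c(2)] uy by blast
    next
      case True
      then obtain y' where y': "y' \<in> B1" "c0 u = c0 y'" by blast
      have y'Z: "y' \<notin> Z" using y' u by (auto simp: A2_def)
      have cy': "c u = c y'" using cB1[OF y'(1)] cu y' by simp
      have pp: "p \<in> A" "p \<noteq> a" "unique_at a c p" using p cA[of p] by auto
      have y'B: "y' \<in> B" "E a y'" using y' B1 by blast+
      obtain c' where c': "colours a c'" "c' u = c y" "\<And>w. w \<in> Nb a \<Longrightarrow> w \<noteq> u \<Longrightarrow> c' w = c w"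
        using swap_unique[OF c(1) a pp yB c(2) uA uy y'B cy'] by blast
      have uniq: "unique_at a c' y'"
        unfolding unique_at_def
      proof (intro ballI impI)
        fix w assume w: "w \<in> Nb a" "w \<noteq> y'"
        have uy': "u \<noteq> y'" using uA y'B disj by blast
        have e: "c' y' = c y'" using c'(3)[OF B1_Nb[OF y'(1)]] uy' by simp
        show "c' w \<noteq> c' y'"
        proof (cases "w = u")
          case True
          have "y \<in> B1" "y \<noteq> y'" using y ZB1 y'Z by auto
          then show ?thesis using True c'(2) e B1_neq[OF c(1) _ y'(1)] by auto
        next
          case False
          then have cw: "c' w = c w" using c'(3) w by blast
          show ?thesis using Nb_cases[OF w(1)]
          proof
            assume "w \<in> A - {a}"
            then show ?thesis using A_neq[OF c(1), of w u] uA False cw e cy' by auto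
          next
            assume "w \<in> B1" then show ?thesis using B1_neq[OF c'(1)] y' w by blast
          qed
        qed
      qed
      have agree: "c' w = c0 w \<or> w \<in> A \<and> c0 w \<in> c0 ` insert y' Z" if w: "w \<in> Nb a" for w
      proof (cases "w = u")
        case True then show ?thesis using uA y' by simp
      next
        case False then show ?thesis using cc0[OF w] c'(3)[OF w] by auto
      qed
      have "good (insert y' Z)"
        unfolding good_def
      proof (intro conjI ballI impI)
        show "insert y' Z \<subseteq> B1" using y' ZB1 by blast
        show "q \<in> insert y' Z" if "q \<in> B1" "c0 q \<notin> c0 ` (A - {a})" for q
          using Z that unfolding good_def by blast
        fix z assume "z \<in> insert y' Z"
        then consider "z = y'" | "z \<in> Z" by blast
        then show "\<exists>c. colours a c \<and> unique_at a c z \<and>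
            (\<forall>u\<in>Nb a. c u = c0 u \<or> u \<in> A \<and> c0 u \<in> c0 ` insert y' Z)"
        proof cases
          case 1 then show ?thesis using c'(1) uniq agree by blast
        next
          case 2
          then obtain e where "colours a e" "unique_at a e z"
            "\<And>u. u \<in> Nb a \<Longrightarrow> e u = c0 u \<or> u \<in> A \<and> c0 u \<in> c0 ` Z"
            using Z unfolding good_def by meson
          then show ?thesis by (intro exI[of _ e]) blast
        qed
      qed
      then have "card (insert y' Z) \<le> card Z" using maxZ by blast
      then show False using y'Z finZ by simp
    qed
  qed
  have A2A: "A2 \<subseteq> A - {a}" by (auto simp: A2_def)
  have "is_clique E (insert a (A2 \<union> Z))"
    unfolding is_clique_def
  proof (intro ballI impI)
    fix u w assume uw: "u \<in> insert a (A2 \<union> Z)" "w \<in> insert a (A2 \<union> Z)" "u \<noteq> w"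
    have Z1: "E b b'" if "b \<in> Z" "b' \<in> Z" "b \<noteq> b'" for b b'
      using nbr_clique[OF aA, of b b'] that ZB1 B1 by blast
    have Z2: "E b z" "E z b" if "b \<in> A2 \<union> {a}" "z \<in> Z" for b z
      using adj[of b z] that ZB1 B1 sym by blast+
    consider "u \<in> A" "w \<in> A" | "u \<in> Z" "w \<in> Z" | "u \<in> A2 \<union> {a}" "w \<in> Z" | "u \<in> Z" "w \<in> A2 \<union> {a}"
      using uw A2A aA by blast
    then show "E u w" using A_adj[of u w] Z1[of u w] Z2 uw(3) by cases blast+
  qed
  moreover have "insert a (A2 \<union> Z) \<subseteq> A \<union> B" using A2A aA ZB1 B1 by blast
  ultimately have "card (insert a (A2 \<union> Z)) \<le> k" using card_clique_le[OF fin] by blast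
  moreover have finA2: "finite A2" using A2A finA finite_subset by blast
  moreover have "a \<notin> A2 \<union> Z" using A2A ZB1 B1 aB by blast
  ultimately have "card (A2 \<union> Z) < k" using finZ by simp
  moreover have "{..<k} \<subseteq> c0 ` (A2 \<union> Z)"
  proof
    fix i assume "i \<in> {..<k}"
    then obtain u where u: "u \<in> Nb a" "c0 u = i" using all_colours_at[OF c0 aA] by blast
    show "i \<in> c0 ` (A2 \<union> Z)"
    proof (cases "i \<in> c0 ` Z")
      case False
      have "\<exists>w\<in>A - {a}. c0 w = i" using Nb_cases[OF u(1)]
      proof
        assume "u \<in> B1"
        then have "c0 u \<in> c0 ` (A - {a})" using Z False u(2) unfolding good_def by blast
        then show ?thesis using u(2) by auto
      qed (use u in blast)
      then show ?thesis using False by (auto simp: A2_def)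
    qed blast
  qed
  ultimately show False
    using card_mono[of "c0 ` (A2 \<union> Z)" "{..<k}"] card_image_le[of "A2 \<union> Z" c0] finA2 finZ by simp
qed

end

section \<open>Graphs without fork and P6\<close>

locale fork_P6_free = ugraph +
  fixes V :: "'a set"
  assumes fin_V: "finite V"
    and fork_free: "free_of V E 5 fork_adj"
    and P6_free: "free_of V E 6 path_adj"
begin

text \<open>The path is \<open>a\<close>, \<open>b\<close>, \<open>c\<close> with leaves
  \<open>d\<close> and \<open>e\<close> at \<open>c\<close>. The adjacency pattern separates all
  vertices except these twin leaves, which explains the inequality among the assumptions.\<close>

lemma no_fork:
  assumes "{a, b, c, d, e} \<subseteq> V" "d \<noteq> e" "E a b" "E b c" "E c d" "E c e"
    "\<not> E a c" "\<not> E a d" "\<not> E a e" "\<not> E b d" "\<not> E b e" "\<not> E d e"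
  shows False
proof -
  define f where "f = (!) [a, b, c, d, e]"
  have f: "f 0 = a" "f (Suc 0) = b" "f 2 = c" "f 3 = d" "f 4 = e" by (simp_all add: f_def)
  have five: "{0..<5} = {0, 1, 2, 3, 4 :: nat}" by auto
  have all5: "(\<forall>i<5. P i) \<longleftrightarrow> P 0 \<and> P 1 \<and> P 2 \<and> P 3 \<and> P (4::nat)" for P
    by (simp add: numeral_eq_Suc All_less_Suc conj_ac)
  have "distinct [a, b, c, d, e]"
    using assms(2-) assms(3-6)[THEN sym] irrefl by auto
  then have "inj_on f {0..<5}" unfolding five inj_on_def by (auto simp: f)
  moreover have "f ` {0..<5} \<subseteq> V" unfolding five using assms(1) by (auto simp: f)
  moreover have "\<forall>i<5. \<forall>j<5. i \<noteq> j \<longrightarrow> E (f i) (f j) \<longleftrightarrow> fork_adj i j"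
    unfolding all5 using assms(2-) assms(3-6)[THEN sym] assms(7-)[THEN not_sym]
    by (auto simp: f fork_adj_def doubleton_eq_iff)
  ultimately show False using fork_free unfolding free_of_def contains_induced_def by blast
qed

lemma no_P6:
  assumes "{a, b, c, d, e, g} \<subseteq> V" "E a b" "E b c" "E c d" "E d e" "E e g"
    "\<not> E a c" "\<not> E a d" "\<not> E a e" "\<not> E a g" "\<not> E b d" "\<not> E b e" "\<not> E b g"
    "\<not> E c e" "\<not> E c g" "\<not> E d g"
  shows False
proof -
  define f where "f = (!) [a, b, c, d, e, g]"
  have f: "f 0 = a" "f (Suc 0) = b" "f 2 = c" "f 3 = d" "f 4 = e" "f 5 = g" by (simp_all add: f_def)
  have six: "{0..<6} = {0, 1, 2, 3, 4, 5 :: nat}" by auto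
  have all6: "(\<forall>i<6. P i) \<longleftrightarrow> P 0 \<and> P 1 \<and> P 2 \<and> P 3 \<and> P 4 \<and> P (5::nat)" for P
    by (simp add: numeral_eq_Suc All_less_Suc conj_ac)
  have "distinct [a, b, c, d, e, g]"
    using assms(2-) assms(2-6)[THEN sym] irrefl by auto
  then have "inj_on f {0..<6}" unfolding six inj_on_def by (auto simp: f)
  moreover have "f ` {0..<6} \<subseteq> V" unfolding six using assms(1) by (auto simp: f)
  moreover have "\<forall>i<6. \<forall>j<6. i \<noteq> j \<longrightarrow> E (f i) (f j) \<longleftrightarrow> path_adj i j"
    unfolding all6 using assms(2-) assms(2-6)[THEN sym] assms(7-)[THEN not_sym]
    by (auto simp: f path_adj_def)
  ultimately show False using P6_free unfolding free_of_def contains_induced_def by blast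
qed

text \<open>If \<open>x\<close> were mixed on \<open>W\<close>, its neighbours and non-neighbours
  there would form a \<open>clique_split\<close> with non-empty \<open>A\<close>, which is
  impossible.\<close>

lemma nbr_of_anticomplete_is_pure:
  assumes W: "W \<subseteq> V" "min_imperfect E W"
    and z: "z \<in> V - W" "\<And>w. w \<in> W \<Longrightarrow> \<not> E z w"
    and x: "x \<in> V - W" "E x z"
    and w: "w \<in> W" "E x w" and u: "u \<in> W"
  shows "E x u"
proof (rule ccontr)
  assume xu: "\<not> E x u"
  define A where "A = {y \<in> W. E x y}"
  define B where "B = {y \<in> W. \<not> E x y}"
  have AB: "A \<union> B = W" "A \<inter> B = {}" by (auto simp: A_def B_def)
  have A: "y \<in> V \<and> y \<in> W \<and> E x y \<and> E y x \<and> \<not> E z y \<and> \<not> E y z" if "y \<in> A" for y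
    using that W z(2)[of y] sym by (auto simp: A_def)
  have B: "y \<in> V \<and> y \<in> W \<and> \<not> E x y \<and> \<not> E y x \<and> \<not> E z y \<and> \<not> E y z" if "y \<in> B" for y
    using that W z(2)[of y] sym by (auto simp: B_def)
  have xz: "x \<in> V" "z \<in> V" "E z x" using x z sym by auto
  have "is_clique E A"
    unfolding is_clique_def
  proof (intro ballI impI, rule ccontr)
    fix a a' assume a: "a \<in> A" "a' \<in> A" "a \<noteq> a'" "\<not> E a a'"
    \<comment> \<open>A maximal co-connected \<open>S\<close> containing a non-edge of
      \<open>A\<close> is homogeneous in \<open>W\<close>: other vertices of \<open>A\<close> are
      complete to \<open>S\<close> by maximality, and a vertex \<open>y\<close> of \<open>B\<close>
      mixed on \<open>S\<close> yields the fork with path \<open>y\<close>, \<open>s\<close>,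
      \<open>x\<close> and leaves \<open>z\<close>, \<open>t\<close>.\<close>
    let ?C = "{S. S \<subseteq> A \<and> coconnected E S}"
    have finA: "finite A" using W fin_V finite_subset by (metis A_def Collect_subset)
    then have finC: "finite ?C" by (intro finite_subset[of ?C "Pow A"]) auto
    have "coconnected E {a}" unfolding coconnected_def by auto
    then have "coconnected E {a', a}"
      using coconnected_insert[of "{a}" a a'] a sym by blast
    then have "{a', a} \<in> ?C" using a by simp
    from finite_has_maximal2[OF finC this]
    obtain S where SC: "S \<in> ?C" "{a', a} \<subseteq> S \<and> (\<forall>T\<in>?C. S \<subseteq> T \<longrightarrow> S = T)" by (rule bexE)
    then have S: "S \<subseteq> A" "coconnected E S" "{a', a} \<subseteq> S" by simp_all
    have max: "S = T" if "T \<subseteq> A" "coconnected E T" "S \<subseteq> T" for T using SC(2) that by simp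
    have "(\<forall>s\<in>S. E y s) \<or> (\<forall>s\<in>S. \<not> E y s)" if y: "y \<in> W - S" for y
    proof (cases "y \<in> A")
      case True
      have "E y s" if "s \<in> S" for s
      proof (rule ccontr)
        assume "\<not> E y s"
        then have "coconnected E (insert y S)" using coconnected_insert[OF S(2) that] by blast
        then have "S = insert y S" using S(1) True by (intro max) auto
        then show False using y by blast
      qed
      then show ?thesis by blast
    next
      case False
      then have yB: "y \<in> B" using y AB by blast
      show ?thesis
      proof (rule ccontr)
        assume "\<not> ?thesis"
        then obtain s0 t0 where "s0 \<in> S" "E y s0" "t0 \<in> S" "\<not> E y t0" by blast
        then obtain s t where st: "s \<in> S" "t \<in> S" "E y s" "\<not> E y t" "\<not> E s t" "s \<noteq> t"
          using coconnected_mixed[OF S(2)] by blast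
        have stA: "s \<in> A" "t \<in> A" using st S by blast+
        show False
        proof (rule no_fork[of y s x z t])
          show "z \<noteq> t" using A[OF stA(2)] z by blast
        qed (use A[OF stA(1)] A[OF stA(2)] B[OF yB] xz x st in auto)
      qed
    qed
    moreover have "card {a', a} \<le> card S" using S finite_subset[OF S(1) finA] by (intro card_mono)
    then have "1 < card S" using a by simp
    moreover have "card S < card W"
    proof (rule psubset_card_mono)
      show "finite W" using W fin_V finite_subset by blast
      show "S \<subset> W" using S u xu AB by (auto simp: A_def)
    qed
    ultimately have "homogeneous_set W E S" using S AB unfolding homogeneous_set_def by blast
    then show False using min_imperfect_no_homogeneous[OF W(2)] by blast
  qed
  then interpret clique_split E A B
  proof unfold_locales
    show "min_imperfect E (A \<union> B)" using W AB by simp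
    show "A \<inter> B = {}" by (rule AB)
    fix a b y assume a: "a \<in> A" and b: "b \<in> B" and y: "y \<in> B"
    note f = A[OF a] B[OF b] B[OF y] xz x
    {
      assume h: "E a b" "E a y" "b \<noteq> y"
      show "E b y"
      proof (rule ccontr)
        assume "\<not> E b y"
        with h show False by (intro no_fork[of z x a b y]) (use f in auto)
      qed
    }
    fix t assume t: "t \<in> B"
    note f = f B[OF t]
    {
      assume h: "E a b" "E b y" "E b t" "\<not> E a y" "\<not> E a t" "y \<noteq> t"
      show "E y t"
      proof (rule ccontr)
        assume "\<not> E y t"
        with h show False by (intro no_fork[of x a b y t]) (use f in auto)
      qed
    }
    {
      assume h: "E a b" "E b y" "E y t" "\<not> E a y" "\<not> E a t" "\<not> E b t"
      then show False by (intro no_P6[of z x a b y t]) (use f in auto)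
    }
  qed
  show False using nonempty_split_impossible w by (auto simp: A_def)
qed

text \<open>The homogeneous set is a maximal co-connected extension S of W that has no edge to the
  set Z of vertices anticomplete to W and to which all neighbours of Z are complete: a vertex
  mixed on S could be added to S by fork-freeness.\<close>
lemma homogeneous_if_imperfect_nonneighbours:
  assumes W: "W \<subseteq> V" "min_imperfect E W"
    and v: "v \<in> V - W" "\<And>w. w \<in> W \<Longrightarrow> \<not> E v w"
  shows "\<exists>S. homogeneous_set V E S"
proof -
  define Z where "Z = {z \<in> V - W. \<forall>w\<in>W. \<not> E z w}"
  have vZ: "v \<in> Z" using v by (simp add: Z_def)
  define ok where "ok S \<longleftrightarrow> W \<subseteq> S \<and> S \<subseteq> V \<and> S \<inter> Z = {} \<and> coconnected E S \<and>
    (\<forall>s\<in>S. \<forall>z\<in>Z. \<not> E z s) \<and>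
    (\<forall>y\<in>V - S - Z. (\<exists>z\<in>Z. E y z) \<longrightarrow> (\<forall>s\<in>S. E y s))" for S
  have okW: "W \<in> {S. ok S}"
    unfolding ok_def mem_Collect_eq
  proof (intro conjI ballI impI)
    fix y s assume y: "y \<in> V - W - Z" "\<exists>z\<in>Z. E y z" and s: "s \<in> W"
    \<comment> \<open>Lying outside \<open>Z\<close>, \<open>y\<close> has a neighbour in
      \<open>W\<close>, so it is not anticomplete to \<open>W\<close> and purity makes it
      complete.\<close>
    then obtain z w where "z \<in> Z" "E y z" "w \<in> W" "E y w" unfolding Z_def by blast
    then show "E y s" using nbr_of_anticomplete_is_pure[OF W, of z y w s] y s unfolding Z_def by blast
  qed (use W min_imperfect_coconnected in \<open>auto simp: Z_def\<close>)
  have "{S. ok S} \<subseteq> Pow V" by (simp add: ok_def subset_iff)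
  then have "finite {S. ok S}" using fin_V finite_subset by blast
  from finite_has_maximal2[OF this okW]
  obtain S where SC: "S \<in> {S. ok S}" "W \<subseteq> S \<and> (\<forall>T\<in>{S. ok S}. S \<subseteq> T \<longrightarrow> S = T)"
    by (rule bexE)
  then have S: "ok S" by simp
  have max: "S = T" if "ok T" "S \<subseteq> T" for T using SC(2) that by simp
  have SV: "W \<subseteq> S" "S \<subseteq> V" "S \<inter> Z = {}" and co: "coconnected E S"
    and SZ: "\<And>s z. s \<in> S \<Longrightarrow> z \<in> Z \<Longrightarrow> \<not> E z s"
    and compl: "\<And>y z s. y \<in> V - S - Z \<Longrightarrow> z \<in> Z \<Longrightarrow> E y z \<Longrightarrow> s \<in> S \<Longrightarrow> E y s"
    using S unfolding ok_def by blast+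
  have pure: "(\<forall>s\<in>S. E u s) \<or> (\<forall>s\<in>S. \<not> E u s)" if u: "u \<in> V - S" for u
  proof (rule ccontr)
    assume "\<not> ?thesis"
    then obtain s0 t0 where s0: "s0 \<in> S" "E u s0" "t0 \<in> S" "\<not> E u t0" by blast
    then obtain s t where st: "s \<in> S" "t \<in> S" "E u s" "\<not> E u t" "\<not> E s t" "s \<noteq> t"
      using coconnected_mixed[OF co] by blast
    have uZ: "u \<notin> Z" using SZ st by blast
    \<comment> \<open>A neighbour of \<open>Z\<close> is complete to \<open>S\<close>, whereas
      \<open>u\<close> misses \<open>t\<close>.\<close>
    have uZ': "\<not> E z u" if "z \<in> Z" for z using compl[of u z t] that st u uZ sym by blast
    have "ok (insert u S)"
      unfolding ok_def
    proof (intro conjI ballI impI)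
      show "W \<subseteq> insert u S" "insert u S \<subseteq> V" "insert u S \<inter> Z = {}" using SV u uZ by auto
      show "coconnected E (insert u S)" using coconnected_insert[OF co st(2,4)] .
      show "\<not> E z s" if "s \<in> insert u S" "z \<in> Z" for s z using that SZ uZ' by blast
      fix y r assume y: "y \<in> V - insert u S - Z" "\<exists>z\<in>Z. E y z" and r: "r \<in> insert u S"
      then obtain z where z: "z \<in> Z" "E y z" by blast
      have yS: "E y r" if "r \<in> S" for r using compl[of y z r] y z that by blast
      have "E y u"
      proof (rule ccontr)
        assume yu: "\<not> E y u"
        have zV: "z \<in> V" "z \<notin> S" using z SV unfolding Z_def by blast+
        \<comment> \<open>The fork has path \<open>u\<close>, \<open>s\<close>, \<open>y\<close> and
          leaves \<open>z\<close>, \<open>t\<close>.\<close>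
        show False
        proof (rule no_fork[of u s y z t])
          show "{u, s, y, z, t} \<subseteq> V" using u st y zV SV by blast
          show "z \<noteq> t" using zV st by blast
          show "\<not> E u z" "\<not> E s z" "\<not> E z t" using uZ' SZ z st sym by blast+
          show "E u s" "\<not> E u t" "\<not> E s t" "E y z" by (fact st z)+
          show "E s y" "E y t" using yS st sym by blast+
          show "\<not> E u y" using yu sym by blast
        qed
      qed
      then show "E y r" using r yS by blast
    qed
    then have "S = insert u S" by (rule max) blast
    then show False using u by blast
  qed
  have "1 < card W"
  proof (rule ccontr)
    assume "\<not> 1 < card W"
    moreover have "finite W" using W by (simp add: min_imperfect_def)
    ultimately have "is_clique E W" unfolding is_clique_def
      by (metis card_le_Suc0_iff_eq One_nat_def not_less)
    then show False using min_imperfect_not_clique[OF W(2)] by blast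
  qed
  moreover have "card W \<le> card S" using SV fin_V finite_subset by (intro card_mono) auto
  moreover have "card S < card V"
    using SV vZ v by (intro psubset_card_mono[OF fin_V]) blast
  ultimately have "homogeneous_set V E S" unfolding homogeneous_set_def using SV pure by auto
  then show ?thesis by blast
qed

end

section \<open>Reduction of perfect divisibility to minimally imperfect sets\<close>

lemma is_clique_cong:
  assumes "\<And>x y. x \<in> S \<Longrightarrow> y \<in> S \<Longrightarrow> E x y = E' x y" "K \<subseteq> S"
  shows "is_clique E K = is_clique E' K"
  using assms unfolding is_clique_def by blast

lemma clique_number_cong:
  assumes "\<And>x y. x \<in> S \<Longrightarrow> y \<in> S \<Longrightarrow> E x y = E' x y"
  shows "clique_number S E = clique_number S E'"
proof -
  have "{card K | K. K \<subseteq> S \<and> is_clique E K} = {card K | K. K \<subseteq> S \<and> is_clique E' K}"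
    using is_clique_cong[of S E E'] assms by metis
  then show ?thesis unfolding clique_number_def by simp
qed

lemma proper_colouring_cong:
  assumes "\<And>x y. x \<in> S \<Longrightarrow> y \<in> S \<Longrightarrow> E x y = E' x y"
  shows "proper_colouring S E k c = proper_colouring S E' k c"
  using assms unfolding proper_colouring_def by auto

text \<open>Every proper colouring is injective on a maximum clique, so fewer colours cannot
  suffice.\<close>

lemma chromatic_number_eqI:
  assumes "finite S" "proper_colouring S E (clique_number S E) c"
  shows "chromatic_number S E = clique_number S E"
  unfolding chromatic_number_def
proof (rule Least_equality)
  show "\<exists>c. proper_colouring S E (clique_number S E) c" using assms by blast
  fix k assume "\<exists>c. proper_colouring S E k c"
  then obtain d where d: "proper_colouring S E k d" by blast
  obtain K where K: "K \<subseteq> S" "is_clique E K" "card K = clique_number S E"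
    using clique_number_attained[OF assms(1)] by metis
  have "card K = card (d ` K)" using inj_on_proper_clique[OF d K(1,2)] by (simp add: card_image)
  also have "\<dots> \<le> card {..<k}"
    using d K(1) unfolding proper_colouring_def by (intro card_mono) auto
  finally show "clique_number S E \<le> k" using K by simp
qed

lemma imperfect_contains_min_imperfect:
  assumes "finite S" "\<not> perfect S E"
  obtains W where "W \<subseteq> S" "min_imperfect E W"
proof -
  obtain H where H: "H \<subseteq> S" "chromatic_number H E \<noteq> clique_number H E"
    using assms(2) unfolding perfect_def by blast
  have "finite H" using H assms finite_subset by blast
  then obtain W where "W \<subseteq> H" "min_imperfect E W"
    using ex_min_imperfect_subset[of H E] chromatic_number_eqI[of H E] H(2) by metis
  then show ?thesis using that H by blast
qed

text \<open>Take any \<open>v\<close> in an induced subgraph \<open>H\<close> without a division. As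
  \<open>v\<close> extends every clique among its neighbours, these have smaller clique number than
  \<open>H\<close>, so the remaining vertices cannot be perfect.\<close>

lemma not_perfectly_divisible_imperfect_nonneighbours:
  assumes G: "simple_graph V E" and "\<not> perfectly_divisible V E"
  obtains v W where "v \<in> V" "W \<subseteq> V - {v}" "\<And>w. w \<in> W \<Longrightarrow> \<not> E v w" "min_imperfect E W"
proof -
  obtain H where H: "H \<subseteq> V" "H \<noteq> {}" and
    no: "\<nexists>A B. A \<union> B = H \<and> A \<inter> B = {} \<and> perfect A E \<and> clique_number B E < clique_number H E"
    using assms(2) unfolding perfectly_divisible_def not_all not_imp by (elim exE conjE)
  obtain v where v: "v \<in> H" using H by blast
  have irr: "\<not> E v v" and symV: "\<And>u. u \<in> V \<Longrightarrow> E v u = E u v"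
    using G H v unfolding simple_graph_def by blast+
  have finH: "finite H" using G H finite_subset unfolding simple_graph_def by blast
  let ?A = "{u \<in> H. \<not> E v u}" and ?B = "{u \<in> H. E v u}"
  obtain K where K: "K \<subseteq> ?B" "is_clique E K" "card K = clique_number ?B E"
    using clique_number_attained[of ?B E] finH by auto
  have "is_clique E (insert v K)"
    using K symV H unfolding is_clique_def by blast
  then have "card (insert v K) \<le> clique_number H E"
    using K v by (intro card_clique_le[OF finH]) auto
  moreover have "v \<notin> K" "finite K" using K irr finite_subset[OF K(1)] finH by auto
  ultimately have "clique_number ?B E < clique_number H E" using K by simp
  moreover have "?A \<union> ?B = H" "?A \<inter> ?B = {}" by auto
  ultimately have "\<not> perfect ?A E" using no by metis
  then obtain W where W: "W \<subseteq> ?A" "min_imperfect E W"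
    using imperfect_contains_min_imperfect[of ?A E] finH by auto
  \<comment> \<open>\<open>v\<close> belongs to \<open>?A\<close> but would be isolated in
    \<open>W\<close>, so a colouring of \<open>W - {v}\<close> extends to it with colour 0,
    available since the clique number is positive.\<close>
  have "v \<notin> W"
  proof
    assume vW: "v \<in> W"
    then have sub: "W - {v} \<subset> W" by blast
    have finW: "finite W" using W by (simp add: min_imperfect_def)
    obtain c where c: "proper_colouring (W - {v}) E (clique_number W E) c"
      using min_imperfect_colourable[OF W(2) sub clique_number_mono[OF finW]] by blast
    have "is_clique E {v}" by (simp add: is_clique_def)
    then have pos: "0 < clique_number W E" using card_clique_le[OF finW, of "{v}" E] vW by simp
    have iso: "\<not> E v w \<and> \<not> E w v" if "w \<in> W" for w using that W(1) symV H by blast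
    have "proper_colouring W E (clique_number W E) (c(v := 0))"
      using c pos iso unfolding proper_colouring_def by auto
    then show False using W unfolding min_imperfect_def by blast
  qed
  then show ?thesis using that[of v W] W H v by blast
qed

theorem theorem3p1:
  fixes V :: "'a set" and E :: "'a \<Rightarrow> 'a \<Rightarrow> bool"
  assumes "simple_graph V E"
    and "free_of V E 5 fork_adj"
    and "free_of V E 6 path_adj"
    and "\<not> perfectly_divisible V E"
  shows "\<exists>S. homogeneous_set V E S"
proof -
  \<comment> \<open>\<open>simple_graph\<close> restricts \<open>E\<close> only on \<open>V\<close>,
    while the locales need symmetry and irreflexivity on the whole type; hence the truncated
    relation.\<close>
  define F where "F x y \<longleftrightarrow> x \<in> V \<and> y \<in> V \<and> E x y" for x y
  have FE: "F x y = E x y" if "x \<in> V" "y \<in> V" for x y using that by (simp add: F_def)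
  have free: "free_of V F n HE" if "free_of V E n HE" for n HE
  proof -
    have "E (f i) (f j) = F (f i) (f j)" if "f ` {0..<n} \<subseteq> V" "i < n" "j < n" for f i j
    proof -
      have "f i \<in> V" "f j \<in> V" using that by auto
      then show ?thesis by (simp add: FE)
    qed
    with that show ?thesis unfolding free_of_def contains_induced_def by metis
  qed
  interpret fork_P6_free F V
    using assms(1) free[OF assms(2)] free[OF assms(3)]
    by unfold_locales (auto simp: simple_graph_def F_def)
  obtain v W where v: "v \<in> V" "W \<subseteq> V - {v}" "\<And>w. w \<in> W \<Longrightarrow> \<not> E v w" and W: "min_imperfect E W"
    using not_perfectly_divisible_imperfect_nonneighbours[OF assms(1,4)] by metis
  have EF: "E x y = F x y" if "x \<in> H" "y \<in> H" "H \<subseteq> W" for x y H using that v(2) FE by blast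
  have cong: "proper_colouring H E (clique_number H E) c = proper_colouring H F (clique_number H F) c"
    if "H \<subseteq> W" for H c
    using clique_number_cong[of H E F] proper_colouring_cong[of H E F] EF[OF _ _ that] by simp
  have "min_imperfect F W"
    using W cong unfolding min_imperfect_def by (metis psubset_imp_subset order_refl)
  moreover have "\<not> F v w" if "w \<in> W" for w using v(3)[OF that] by (simp add: F_def)
  ultimately obtain S where S: "homogeneous_set V F S"
    using homogeneous_if_imperfect_nonneighbours[of W v] v(1,2) by blast
  then have "homogeneous_set V E S"
    using FE unfolding homogeneous_set_def by (metis DiffD1 subsetD)
  then show ?thesis by blast
qed

end
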